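(* Let $\mathbb{X}$ be a self-adjoint element of $\mathcal{A}$ with $\varphi$-law $\mu$ and $\psi$-law $\nu$. Then for every integer $k\ge 1$, $$C^{(k)}_{\varphi,\psi}(z)=\mathcal{R}^{(k)}_{\mathbb{X}}\big(zM_\nu(z)\big)\,z^k M_\mu(z),$$ where $\mathcal{R}^{(k)}_{\mathbb{X}}(z)=\sum_{i=k}^{\infty}R_i(\mathbb{X})z^{i-k}$.
   Context: $\mathcal{A}$ is a unital $*$-algebra with two states (positive normalized linear functionals) $\varphi,\psi:\mathcal{A}\to\mathbb{C}$; $\psi$ is tracial, $\varphi$ need not be. Each self-adjoint $\mathbb{X}\in\mathcal{A}$ has a $\varphi$-law $\mu$ and a $\psi$-law $\nu$, compactly supported probability measures on $\mathbb{R}$ with $\varphi(\mathbb{X}^n)=\int x^n\mu(dx)$, $\psi(\mathbb{X}^n)=\int x^n\nu(dx)$. $NC(n)$ is the set of non-crossing partitions of $\{1,\dots,n\}$. A block $V$ of $\pi\in NC(n)$ is inner if there are $p,q\notin V$ lying in one common other block of $\pi$ with $p<x<q$ for all $x\in V$; otherwise it is outer. $Inn(\pi)$, $Out(\pi)$ are the sets of inner and outer blocks. The free cumulants $r_k$ and the two-state free cumulants $R_k$ are the multilinear maps $\mathcal{A}^k\to\mathbb{C}$ determined recursively by $$\psi(\mathbb{X}_1\cdots\mathbb{X}_n)=\sum_{\pi\in NC(n)}\prod_{B\in\pi}r_{|B|}(\mathbb{X}_i:i\in B),$$ $$\varphi(\mathbb{X}_1\cdots\mathbb{X}_n)=\sum_{\pi\in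 NC(n)}\prod_{B\in Out(\pi)}R_{|B|}(\mathbb{X}_i:i\in B)\prod_{B\in Inn(\pi)}r_{|B|}(\mathbb{X}_i:i\in B).$$ Write $R_k(\mathbb{X})=R_k(\mathbb{X},\dots,\mathbb{X})$. $M_\mu(z)=\sum_{i\ge0}z^i\varphi(\mathbb{X}^i)$, $M_\nu(z)=\sum_{i\ge0}z^i\psi(\mathbb{X}^i)$. For $1\le k\le n$, $$\varphi_k(\mathbb{X}^n)=\sum_{j=k}^n\ \sum_{s_1=1<s_2=2<\dots<s_k=k<s_{k+1}<\dots<s_j\le n}R_j(\mathbb{X})\,\varphi(\mathbb{X}^{n-s_j})\prod_{r=k}^{j-1}\psi(\mathbb{X}^{s_{r+1}-1-s_r})$$ (the part of the cumulant expansion of $\varphi(\mathbb{X}^n)$ in which the first $k$ elements are in the same block; $\varphi(\mathbb{X}^0)=\psi(\mathbb{X}^0)=1$), and $C^{(k)}_{\varphi,\psi}(z)=\sum_{n=0}^\infty\varphi_k(\mathbb{X}^{k+n})z^{k+n}$. Identities of series are understood for $z\in\mathbb{C}$ with $|z|$ sufficiently small (equivalently, as formal power series). *)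

theory Defs
  imports "HOL-Probability.Probability"
begin

section \<open>Unital star-algebras with two states\<close>

text \<open>
  The type-class ring structure of \<open>'a\<close> is the ring structure of the algebra; the complex scalar
  multiplication and the involution are parameters. Requiring \<open>0 \<noteq> 1\<close> (class \<open>ring_1\<close>) is no
  restriction, since the zero algebra carries no normalized functional.
\<close>

locale star_algebra = vector_space scaleC
  for scaleC :: "complex \<Rightarrow> 'a::ring_1 \<Rightarrow> 'a" +
  fixes star :: "'a \<Rightarrow> 'a"
  assumes scaleC_mult_left: "scaleC c a * b = scaleC c (a * b)"
    and scaleC_mult_right: "a * scaleC c b = scaleC c (a * b)"
    and star_star: "star (star a) = a"
    and star_add: "star (a + b) = star a + star b"
    and star_scaleC: "star (scaleC c a) = scaleC (cnj c) (star a)"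
    and star_mult: "star (a * b) = star b * star a"

locale state = star_algebra scaleC star
  for scaleC :: "complex \<Rightarrow> 'a::ring_1 \<Rightarrow> 'a" and star :: "'a \<Rightarrow> 'a" +
  fixes f :: "'a \<Rightarrow> complex"
  assumes linear: "Vector_Spaces.linear scaleC (*) f"
    and positive: "f (star a * a) \<in> \<real>\<^sub>\<ge>\<^sub>0"
    and normalized: "f 1 = 1"

locale two_state_algebra = phi: state scaleC star \<phi> + psi: state scaleC star \<psi>
  for scaleC :: "complex \<Rightarrow> 'a::ring_1 \<Rightarrow> 'a" and star :: "'a \<Rightarrow> 'a"
    and \<phi> \<psi> :: "'a \<Rightarrow> complex" +
  assumes tracial: "\<psi> (a * b) = \<psi> (b * a)"

definition law :: "('a::ring_1 \<Rightarrow> complex) \<Rightarrow> 'a \<Rightarrow> real measure \<Rightarrow> bool" where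
  "law f X \<mu> \<longleftrightarrow>
     prob_space \<mu> \<and> sets \<mu> = sets borel \<and> (\<exists>K. compact K \<and> (AE x in \<mu>. x \<in> K)) \<and>
     (\<forall>n. f (X ^ n) = complex_of_real (\<integral>x. x ^ n \<partial>\<mu>))"


section \<open>Non-crossing partitions\<close>

definition noncrossing :: "nat set set \<Rightarrow> bool" where
  "noncrossing \<pi> \<longleftrightarrow>
     \<not> (\<exists>V\<in>\<pi>. \<exists>W\<in>\<pi>. V \<noteq> W \<and> (\<exists>a\<in>V. \<exists>b\<in>W. \<exists>c\<in>V. \<exists>d\<in>W. a < b \<and> b < c \<and> c < d))"

definition NC :: "nat \<Rightarrow> nat set set set" where
  "NC n = {\<pi>. partition_on {1..n} \<pi> \<and> noncrossing \<pi>}"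

definition Inn :: "nat set set \<Rightarrow> nat set set" where
  "Inn \<pi> = {V \<in> \<pi>. \<exists>W\<in>\<pi>. W \<noteq> V \<and> (\<exists>p\<in>W. \<exists>q\<in>W. \<forall>x\<in>V. p < x \<and> x < q)}"

definition Out :: "nat set set \<Rightarrow> nat set set" where
  "Out \<pi> = \<pi> - Inn \<pi>"

lemma finite_NC: "finite (NC n)"
proof (rule finite_subset)
  show "NC n \<subseteq> Pow (Pow {1..n})"
    by (auto simp: NC_def partition_on_def)
qed simp

lemma NC_finite: "\<pi> \<in> NC n \<Longrightarrow> finite \<pi>"
  by (auto simp: NC_def intro: finite_elements[OF finite_atLeastAtMost])

lemma full_block_in_NC: "n > 0 \<Longrightarrow> {{1..n}} \<in> NC n"
  by (auto simp: NC_def noncrossing_def partition_on_def)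

lemma NC_block_card_less:
  assumes "\<pi> \<in> NC n" "\<pi> \<noteq> {{1..n}}" "B \<in> \<pi>"
  shows "card B < n"
proof -
  have p: "\<Union>\<pi> = {1..n}" "disjoint \<pi>" "{} \<notin> \<pi>"
    using assms(1) by (auto simp: NC_def partition_on_def)
  have sub: "B \<subseteq> {1..n}" using p assms(3) by blast
  have "B \<noteq> {1..n}"
  proof
    assume B: "B = {1..n}"
    have "C = B" if C: "C \<in> \<pi>" for C
    proof (rule ccontr)
      assume "C \<noteq> B"
      then have "C \<inter> B = {}" using p(2) C assms(3) by (auto simp: disjoint_def)
      moreover have "C \<subseteq> B" "C \<noteq> {}" using p C B by auto
      ultimately show False by blast
    qed
    then have "\<pi> = {B}" using assms(3) by blast
    then show False using assms(2) B by blast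
  qed
  then have "B \<subset> {1..n}" using sub by blast
  then have "card B < card {1..n}" by (intro psubset_card_mono) auto
  then show ?thesis by simp
qed


section \<open>Cumulants\<close>

text \<open>
  A \<open>k\<close>-linear map is represented by a function on lists of length \<open>k\<close>. Positions in a list are
  counted from 1, and \<open>subtuple xs B\<close> is the tuple of the entries at the positions in \<open>B\<close>, in
  increasing order.
\<close>

definition subtuple :: "'a list \<Rightarrow> nat set \<Rightarrow> 'a list" where
  "subtuple xs B = map (\<lambda>i. xs ! (i - 1)) (sorted_list_of_set B)"

lemma length_subtuple: "length (subtuple xs B) = card B"
  by (simp add: subtuple_def)

lemma subtuple_full: "subtuple xs {1..length xs} = xs"
proof (rule nth_equalityI)
  fix i assume "i < length (subtuple xs {1..length xs})"
  then have i: "i < length xs" by (simp add: subtuple_def)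
  have "sorted_list_of_set {1..length xs} = [1..<Suc (length xs)]"
    by (metis atLeastLessThanSuc_atLeastAtMost sorted_list_of_set_range)
  then show "subtuple xs {1..length xs} ! i = xs ! i"
    using i by (simp add: subtuple_def del: upt_Suc)
qed (simp add: subtuple_def)

text \<open>
  The moment-cumulant formulas solved for the term of the one-block partition, which is the only
  one containing the cumulant of the whole tuple. The values at the empty list are meaningless.
\<close>

function free_cumulant :: "('a::monoid_mult \<Rightarrow> complex) \<Rightarrow> 'a list \<Rightarrow> complex" where
  "free_cumulant \<psi> xs = \<psi> (prod_list xs) -
     (\<Sum>\<pi> \<in> NC (length xs) - {{{1..length xs}}}. \<Prod>B\<in>\<pi>. free_cumulant \<psi> (subtuple xs B))"
  by pat_completeness auto
termination
  by (relation "Wellfounded.measure (\<lambda>(\<psi>, xs). length xs)")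
     (auto simp: length_subtuple intro!: NC_block_card_less)

declare free_cumulant.simps [simp del]

function two_state_cumulant ::
    "('a::monoid_mult \<Rightarrow> complex) \<Rightarrow> ('a \<Rightarrow> complex) \<Rightarrow> 'a list \<Rightarrow> complex" where
  "two_state_cumulant \<phi> \<psi> xs = \<phi> (prod_list xs) -
     (\<Sum>\<pi> \<in> NC (length xs) - {{{1..length xs}}}.
        (\<Prod>B\<in>Out \<pi>. two_state_cumulant \<phi> \<psi> (subtuple xs B)) *
        (\<Prod>B\<in>Inn \<pi>. free_cumulant \<psi> (subtuple xs B)))"
  by pat_completeness auto
termination
  by (relation "Wellfounded.measure (\<lambda>(\<phi>, \<psi>, xs). length xs)")
     (auto simp: length_subtuple Out_def intro!: NC_block_card_less)

declare two_state_cumulant.simps [simp del]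

theorem moment_free_cumulant:
  assumes "xs \<noteq> []"
  shows "\<psi> (prod_list xs) = (\<Sum>\<pi>\<in>NC (length xs). \<Prod>B\<in>\<pi>. free_cumulant \<psi> (subtuple xs B))"
proof -
  have "{{1..length xs}} \<in> NC (length xs)"
    using assms by (intro full_block_in_NC) simp
  then show ?thesis
    using free_cumulant.simps[of \<psi> xs] subtuple_full[of xs]
    by (simp add: sum.remove[OF finite_NC])
qed

theorem moment_two_state_cumulant:
  assumes "xs \<noteq> []"
  shows "\<phi> (prod_list xs) =
    (\<Sum>\<pi>\<in>NC (length xs).
        (\<Prod>B\<in>Out \<pi>. two_state_cumulant \<phi> \<psi> (subtuple xs B)) *
        (\<Prod>B\<in>Inn \<pi>. free_cumulant \<psi> (subtuple xs B)))"
proof -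
  have "{{1..length xs}} \<in> NC (length xs)"
    using assms by (intro full_block_in_NC) simp
  moreover have "Inn {{1..length xs}} = {}" "Out {{1..length xs}} = {{1..length xs}}"
    by (auto simp: Inn_def Out_def)
  ultimately show ?thesis
    using two_state_cumulant.simps[of \<phi> \<psi> xs] subtuple_full[of xs]
    by (simp add: sum.remove[OF finite_NC])
qed

lemma subtuple_nonempty:
  assumes "\<pi> \<in> NC n" "B \<in> \<pi>"
  shows "subtuple xs B \<noteq> []"
proof -
  have "B \<subseteq> {1..n}" "B \<noteq> {}"
    using assms by (auto simp: NC_def partition_on_def)
  then show ?thesis
    using finite_subset[of B "{1..n}"] by (simp add: subtuple_def)
qed

theorem free_cumulant_unique:
  assumes r: "\<And>xs. xs \<noteq> [] \<Longrightarrow>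
      \<psi> (prod_list xs) = (\<Sum>\<pi>\<in>NC (length xs). \<Prod>B\<in>\<pi>. r (subtuple xs B))"
    and "xs \<noteq> []"
  shows "r xs = free_cumulant \<psi> xs"
  using assms(2)
proof (induction xs rule: length_induct)
  case (1 xs)
  have full: "{{1..length xs}} \<in> NC (length xs)"
    using 1 by (intro full_block_in_NC) simp
  have IH: "r (subtuple xs B) = free_cumulant \<psi> (subtuple xs B)"
    if "\<pi> \<in> NC (length xs) - {{{1..length xs}}}" "B \<in> \<pi>" for \<pi> B
  proof -
    have "length (subtuple xs B) < length xs"
      unfolding length_subtuple using that by (intro NC_block_card_less[of \<pi>]) blast+
    moreover have "subtuple xs B \<noteq> []"
      using that subtuple_nonempty[of \<pi>] by blast
    ultimately show ?thesis using 1(1) by blast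
  qed
  have "(\<Sum>\<pi> \<in> NC (length xs) - {{{1..length xs}}}. \<Prod>B\<in>\<pi>. r (subtuple xs B)) =
      (\<Sum>\<pi> \<in> NC (length xs) - {{{1..length xs}}}. \<Prod>B\<in>\<pi>. free_cumulant \<psi> (subtuple xs B))"
    by (intro sum.cong prod.cong refl IH)
  then show ?case
    using r[OF 1(2)] free_cumulant.simps[of \<psi> xs] subtuple_full[of xs]
    by (simp add: sum.remove[OF finite_NC full])
qed

theorem two_state_cumulant_unique:
  assumes R: "\<And>xs. xs \<noteq> [] \<Longrightarrow>
      \<phi> (prod_list xs) = (\<Sum>\<pi>\<in>NC (length xs).
        (\<Prod>B\<in>Out \<pi>. R (subtuple xs B)) * (\<Prod>B\<in>Inn \<pi>. free_cumulant \<psi> (subtuple xs B)))"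
    and "xs \<noteq> []"
  shows "R xs = two_state_cumulant \<phi> \<psi> xs"
  using assms(2)
proof (induction xs rule: length_induct)
  case (1 xs)
  have full: "{{1..length xs}} \<in> NC (length xs)"
    using 1 by (intro full_block_in_NC) simp
  have IH: "R (subtuple xs B) = two_state_cumulant \<phi> \<psi> (subtuple xs B)"
    if "\<pi> \<in> NC (length xs) - {{{1..length xs}}}" "B \<in> \<pi>" for \<pi> B
  proof -
    have "length (subtuple xs B) < length xs"
      unfolding length_subtuple using that by (intro NC_block_card_less[of \<pi>]) blast+
    moreover have "subtuple xs B \<noteq> []"
      using that subtuple_nonempty[of \<pi>] by blast
    ultimately show ?thesis using 1(1) by blast
  qed
  have one: "Inn {{1..length xs}} = {}" "Out {{1..length xs}} = {{1..length xs}}"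
    by (auto simp: Inn_def Out_def)
  have "(\<Sum>\<pi> \<in> NC (length xs) - {{{1..length xs}}}.
        (\<Prod>B\<in>Out \<pi>. R (subtuple xs B)) * (\<Prod>B\<in>Inn \<pi>. free_cumulant \<psi> (subtuple xs B))) =
      (\<Sum>\<pi> \<in> NC (length xs) - {{{1..length xs}}}.
        (\<Prod>B\<in>Out \<pi>. two_state_cumulant \<phi> \<psi> (subtuple xs B)) *
        (\<Prod>B\<in>Inn \<pi>. free_cumulant \<psi> (subtuple xs B)))"
    by (intro sum.cong prod.cong refl arg_cong2[where f = "(*)"] IH) (auto simp: Out_def)
  then show ?case
    using R[OF 1(2)] two_state_cumulant.simps[of \<phi> \<psi> xs] subtuple_full[of xs] one
    by (simp add: sum.remove[OF finite_NC full])
qed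

definition R_cumulant :: "('a::monoid_mult \<Rightarrow> complex) \<Rightarrow> ('a \<Rightarrow> complex) \<Rightarrow> nat \<Rightarrow> 'a \<Rightarrow> complex" where
  "R_cumulant \<phi> \<psi> k X = two_state_cumulant \<phi> \<psi> (replicate k X)"


section \<open>Generating series\<close>

text \<open>
  Identities of series in \<open>z\<close> are identities of formal power series over the complex numbers.
\<close>

definition M_series :: "('a::monoid_mult \<Rightarrow> complex) \<Rightarrow> 'a \<Rightarrow> complex fps" where
  "M_series f X = Abs_fps (\<lambda>i. f (X ^ i))"

text \<open>
  The sequences \<open>s\<^sub>1 = 1 < \<dots> < s\<^sub>k = k < s\<^sub>k\<^sub>+\<^sub>1 < \<dots> < s\<^sub>j \<le> n\<close>, as functions on \<open>{1..j}\<close> (extended by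
  \<open>undefined\<close>, so that each sequence is counted once).
\<close>

definition block_seqs :: "nat \<Rightarrow> nat \<Rightarrow> nat \<Rightarrow> (nat \<Rightarrow> nat) set" where
  "block_seqs k j n =
     {s \<in> {1..j} \<rightarrow>\<^sub>E {1..n}. strict_mono_on {1..j} s \<and> (\<forall>i\<in>{1..k}. s i = i)}"

definition partial_moment ::
    "('a::monoid_mult \<Rightarrow> complex) \<Rightarrow> ('a \<Rightarrow> complex) \<Rightarrow> nat \<Rightarrow> 'a \<Rightarrow> nat \<Rightarrow> complex" where
  "partial_moment \<phi> \<psi> k X n =
     (\<Sum>j=k..n. \<Sum>s\<in>block_seqs k j n.
        R_cumulant \<phi> \<psi> j X * \<phi> (X ^ (n - s j)) *
        (\<Prod>r=k..<j. \<psi> (X ^ (s (r + 1) - 1 - s r))))"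

definition C_series ::
    "('a::monoid_mult \<Rightarrow> complex) \<Rightarrow> ('a \<Rightarrow> complex) \<Rightarrow> nat \<Rightarrow> 'a \<Rightarrow> complex fps" where
  "C_series \<phi> \<psi> k X = Abs_fps (\<lambda>m. if k \<le> m then partial_moment \<phi> \<psi> k X m else 0)"

definition R_series ::
    "('a::monoid_mult \<Rightarrow> complex) \<Rightarrow> ('a \<Rightarrow> complex) \<Rightarrow> nat \<Rightarrow> 'a \<Rightarrow> complex fps" where
  "R_series \<phi> \<psi> k X = Abs_fps (\<lambda>i. R_cumulant \<phi> \<psi> (k + i) X)"

end

theory Submission
  imports Defs
begin

text \<open>
  Once the first \<open>j\<close> elements of the distinguished block are chosen, summing over the position of
  element \<open>j + 1\<close> is a Cauchy product: the gap before it contributes a \<open>\<psi>\<close>-moment, the element itself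
  a factor \<open>z\<close>. So the blocks of size \<open>j\<close> contribute \<open>R\<^sub>j z\<^sup>k (z M\<^sub>\<nu>(z))\<^sup>j\<^sup>-\<^sup>k M\<^sub>\<mu>(z)\<close>, and summing
  over \<open>j\<close> gives the composition.
\<close>

unbundle no vec_syntax and fps_syntax

lemma block_seqs_last_bounds:
  assumes "s \<in> block_seqs k j n" "1 \<le> j"
  shows "1 \<le> s j" "s j \<le> n"
proof -
  have "s \<in> {1..j} \<rightarrow>\<^sub>E {1..n}" using assms by (simp add: block_seqs_def)
  from PiE_mem[OF this, of j] show "1 \<le> s j" "s j \<le> n" using assms(2) by auto
qed

lemma block_seqs_undefined:
  "s \<in> block_seqs k j n \<Longrightarrow> i \<notin> {1..j} \<Longrightarrow> s i = undefined"
  unfolding block_seqs_def by (blast dest: PiE_arb)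

lemma finite_block_seqs: "finite (block_seqs k j n)"
  by (rule finite_subset[of _ "{1..j} \<rightarrow>\<^sub>E {1..n}"]) (auto simp: block_seqs_def intro: finite_PiE)

text \<open>Base case of the induction on block size. All entries are prescribed and the values
  outside \<open>{1..k}\<close> are \<open>undefined\<close>, so at most one sequence exists; it
  exists when its last entry \<open>k\<close> fits below \<open>n\<close>. For \<open>k = 0\<close>
  there is no last entry to compare with \<open>n\<close>.\<close>

lemma block_seqs_diagonal:
  "block_seqs k k n = (if k \<le> n then {restrict id {1..k}} else {})"
proof -
  have eq: "s = restrict id {1..k}" if "s \<in> block_seqs k k n" for s
  proof
    fix i
    show "s i = restrict id {1..k} i"
      using that block_seqs_undefined[OF that, of i]
      by (cases "i \<in> {1..k}") (auto simp: block_seqs_def)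
  qed
  have "k \<le> n" if "s \<in> block_seqs k k n" for s
  proof (cases "k = 0")
    case False
    then have "s k = k" using that by (simp add: block_seqs_def)
    with block_seqs_last_bounds[OF that] False show ?thesis by simp
  qed simp
  moreover have "restrict id {1..k} \<in> block_seqs k k n" if "k \<le> n"
    using that by (auto simp: block_seqs_def strict_mono_on_def)
  ultimately show ?thesis using eq by auto
qed

text \<open>The old entries all lie at or below \<open>s j\<close>, so comparing \<open>m\<close>
  with \<open>s j\<close> is enough; \<open>k \<le> j\<close> keeps the update away from the
  prescribed entries.\<close>

lemma block_seqs_extend:
  assumes "s \<in> block_seqs k j n" "1 \<le> k" "k \<le> j" "s j < m" "m \<le> n"
  shows "s(Suc j := m) \<in> block_seqs k (Suc j) n"
proof -
  have s: "s \<in> {1..j} \<rightarrow>\<^sub>E {1..n}" "strict_mono_on {1..j} s" "\<forall>i\<in>{1..k}. s i = i"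
    using assms(1) by (auto simp: block_seqs_def)
  have "m \<in> {1..n}" using assms(4,5) by auto
  then have "s(Suc j := m) \<in> {1..Suc j} \<rightarrow>\<^sub>E {1..n}"
    using PiE_fun_upd[OF _ s(1)] by (simp add: atLeastAtMostSuc_conv)
  moreover have "strict_mono_on {1..Suc j} (s(Suc j := m))"
  proof (rule strict_mono_onI)
    fix a b assume ab: "a \<in> {1..Suc j}" "b \<in> {1..Suc j}" "a < b"
    show "(s(Suc j := m)) a < (s(Suc j := m)) b"
    proof (cases "b = Suc j")
      case True
      then have "s a \<le> s j"
        using ab strict_mono_onD[OF s(2), of a j] by (cases "a = j") auto
      then show ?thesis using True ab assms(4) by auto
    next
      case False
      then show ?thesis using ab strict_mono_onD[OF s(2), of a b] by auto
    qed
  qed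
  ultimately show ?thesis using s(3) assms(3) by (auto simp: block_seqs_def)
qed

lemma block_seqs_restrict:
  assumes "s \<in> block_seqs k (Suc j) n" "1 \<le> k" "k \<le> j"
  shows "restrict s {1..j} \<in> block_seqs k j n" "s j < s (Suc j)" "s (Suc j) \<le> n"
proof -
  have s: "s \<in> {1..Suc j} \<rightarrow>\<^sub>E {1..n}" "strict_mono_on {1..Suc j} s" "\<forall>i\<in>{1..k}. s i = i"
    using assms(1) by (auto simp: block_seqs_def)
  have "restrict s {1..j} \<in> {1..j} \<rightarrow>\<^sub>E {1..n}"
    using PiE_mem[OF s(1)] by (intro PiE_I) auto
  moreover have "strict_mono_on {1..j} (restrict s {1..j})"
    using strict_mono_onD[OF s(2)] by (intro strict_mono_onI) auto
  ultimately show "restrict s {1..j} \<in> block_seqs k j n"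
    using s(3) assms(3) by (auto simp: block_seqs_def)
  show "s j < s (Suc j)" using strict_mono_onD[OF s(2), of j "Suc j"] assms by auto
  show "s (Suc j) \<le> n" using block_seqs_last_bounds[OF assms(1)] by simp
qed

text \<open>Splitting off the last entry is a bijection onto pairs of a shorter sequence and a value
  above its last entry. This isolates the choice of one element of the block, which drives the
  induction on block size.\<close>

lemma sum_block_seqs_Suc:
  fixes f :: "(nat \<Rightarrow> nat) \<Rightarrow> 'b::comm_monoid_add"
  assumes "1 \<le> k" "k \<le> j"
  shows "(\<Sum>s\<in>block_seqs k (Suc j) n. f s) =
    (\<Sum>s\<in>block_seqs k j n. \<Sum>m\<in>{s j<..n}. f (s(Suc j := m)))"
proof -
  let ?S = "SIGMA s:block_seqs k j n. {s j<..n}"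
  have "(\<Sum>s\<in>block_seqs k (Suc j) n. f s) = (\<Sum>(s, m)\<in>?S. f (s(Suc j := m)))"
  proof (rule sum.reindex_bij_witness[where i = "\<lambda>(s, m). s(Suc j := m)"
        and j = "\<lambda>s. (restrict s {1..j}, s (Suc j))"])
    fix s assume s: "s \<in> block_seqs k (Suc j) n"
    \<comment> \<open>Outside \<open>{1..Suc j}\<close> both sides are \<open>undefined\<close>, so
      restricting loses only the value at \<open>Suc j\<close>, which the update restores.\<close>
    have upd: "(restrict s {1..j})(Suc j := s (Suc j)) = s"
    proof
      fix i
      show "((restrict s {1..j})(Suc j := s (Suc j))) i = s i"
        using block_seqs_undefined[OF s, of i] by (auto simp: le_Suc_eq)
    qed
    show "(case (restrict s {1..j}, s (Suc j)) of (s, m) \<Rightarrow> s(Suc j := m)) = s"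
      "(case (restrict s {1..j}, s (Suc j)) of (s, m) \<Rightarrow> f (s(Suc j := m))) = f s"
      using upd by simp_all
    show "(restrict s {1..j}, s (Suc j)) \<in> ?S"
      using block_seqs_restrict[OF s assms] assms by auto
  next
    fix p assume "p \<in> ?S"
    then obtain s m where p: "p = (s, m)" "s \<in> block_seqs k j n" "s j < m" "m \<le> n" by auto
    have "restrict (s(Suc j := m)) {1..j} = s"
    proof
      fix i
      show "restrict (s(Suc j := m)) {1..j} i = s i"
        using block_seqs_undefined[OF p(2), of i] by (cases "i \<in> {1..j}") auto
    qed
    then show "(restrict (case p of (s, m) \<Rightarrow> s(Suc j := m)) {1..j},
        (case p of (s, m) \<Rightarrow> s(Suc j := m)) (Suc j)) = p"
      by (simp add: p(1))
    show "(case p of (s, m) \<Rightarrow> s(Suc j := m)) \<in> block_seqs k (Suc j) n"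
      using block_seqs_extend[OF p(2) assms p(3,4)] by (simp add: p(1))
  qed
  then show ?thesis
    by (simp add: sum.Sigma finite_block_seqs)
qed

text \<open>Indexing by the gap length \<open>i = m - 1 - t\<close> gives a Cauchy product of degree
  \<open>n - t - 1\<close>; the element at \<open>m\<close> itself occupies one position, whence the
  factor \<open>fps_X\<close>. For \<open>t = n\<close> the sum is empty and that factor kills the
  constant coefficient.\<close>

lemma sum_gap_convolution:
  fixes G N :: "'b::comm_ring_1 fps"
  assumes "t \<le> n"
  shows "(\<Sum>m\<in>{t<..n}. G $ (n - m) * N $ (m - 1 - t)) = (fps_X * N * G) $ (n - t)"
proof (cases "t = n")
  case False
  with assms have "t < n" by simp
  have "(\<Sum>m\<in>{t<..n}. G $ (n - m) * N $ (m - 1 - t))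
      = (\<Sum>i=0..n - t - 1. N $ i * G $ (n - t - 1 - i))"
    by (rule sum.reindex_bij_witness[where i = "\<lambda>i. Suc (t + i)" and j = "\<lambda>m. m - 1 - t"])
       (use \<open>t < n\<close> in \<open>auto simp: mult.commute Suc_diff_Suc intro!: arg_cong2[where f = "(*)"]
          arg_cong[where f = "fps_nth G"]\<close>)
  also have "\<dots> = (N * G) $ (n - t - 1)"
    by (simp only: fps_mult_nth)
  also have "\<dots> = (fps_X * N * G) $ (n - t)"
    using \<open>t < n\<close> by (simp add: mult.assoc)
  finally show ?thesis .
qed (simp add: mult.assoc)

text \<open>The series \<open>G\<close> is arbitrary because the induction step absorbs the last gap into it.\<close>

lemma sum_block_seqs_eq_fps_nth:
  fixes G N :: "'b::comm_ring_1 fps"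
  assumes "1 \<le> k"
  shows "(\<Sum>s\<in>block_seqs k (k + d) n.
      G $ (n - s (k + d)) * (\<Prod>r=k..<k + d. N $ (s (r + 1) - 1 - s r))) =
    ((fps_X * N) ^ d * fps_X ^ k * G) $ n"
proof (induction d arbitrary: G)
  case 0
  show ?case using assms
    by (simp add: block_seqs_diagonal fps_X_power_mult_nth)
next
  case (Suc d)
  let ?j = "k + d"
  let ?P = "\<lambda>s. \<Prod>r=k..<?j. N $ (s (r + 1) - 1 - s r)"
  \<comment> \<open>The product reads entries up to index \<open>?j\<close> only.\<close>
  have upd: "?P (s(Suc ?j := m)) = ?P s" for s m
    by (intro prod.cong) auto
  have "(\<Sum>s\<in>block_seqs k (k + Suc d) n.
      G $ (n - s (k + Suc d)) * (\<Prod>r=k..<k + Suc d. N $ (s (r + 1) - 1 - s r))) =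
    (\<Sum>s\<in>block_seqs k ?j n. \<Sum>m\<in>{s ?j<..n}. ?P s * (G $ (n - m) * N $ (m - 1 - s ?j)))"
    unfolding add_Suc_right sum_block_seqs_Suc[OF assms le_add1]
    by (simp add: upd mult_ac del: One_nat_def)
  also have "\<dots> = (\<Sum>s\<in>block_seqs k ?j n. (fps_X * N * G) $ (n - s ?j) * ?P s)"
  proof (rule sum.cong[OF refl])
    fix s assume "s \<in> block_seqs k ?j n"
    then have "s ?j \<le> n" using block_seqs_last_bounds assms by simp
    then show "(\<Sum>m\<in>{s ?j<..n}. ?P s * (G $ (n - m) * N $ (m - 1 - s ?j))) =
        (fps_X * N * G) $ (n - s ?j) * ?P s"
      by (simp only: sum_distrib_right[symmetric] sum_gap_convolution mult.commute[of "?P s"])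
  qed
  also have "\<dots> = ((fps_X * N) ^ d * fps_X ^ k * (fps_X * N * G)) $ n"
    by (rule Suc.IH)
  also have "(fps_X * N) ^ d * fps_X ^ k * (fps_X * N * G) = (fps_X * N) ^ Suc d * fps_X ^ k * G"
    by (simp only: power_Suc mult_ac)
  finally show ?case .
qed

text \<open>Lets the composition be expanded in powers of \<open>A\<close> after multiplication by
  \<open>H\<close>, matching the sum over block sizes.\<close>

lemma fps_compose_mult_nth:
  fixes A B H :: "'b::comm_ring_1 fps"
  assumes "A $ 0 = 0"
  shows "(fps_compose B A * H) $ n = (\<Sum>i=0..n. B $ i * (A ^ i * H) $ n)"
proof -
  have "(fps_compose B A * H) $ n = (\<Sum>p=0..n. (\<Sum>i=0..p. B $ i * (A ^ i) $ p) * H $ (n - p))"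
    by (simp add: fps_mult_nth fps_compose_nth)
  \<comment> \<open>Since \<open>A\<close> has no constant term, \<open>A ^ i\<close> has no
    coefficient at degree \<open>p < i\<close>; the inner range can thus be made independent of
    \<open>p\<close> before the sums are swapped.\<close>
  also have "\<dots> = (\<Sum>p=0..n. (\<Sum>i=0..n. B $ i * (A ^ i) $ p) * H $ (n - p))"
    by (intro sum.cong refl arg_cong2[where f = "(*)"] sum.mono_neutral_left)
       (use assms in \<open>auto simp: startsby_zero_power_prefix\<close>)
  also have "\<dots> = (\<Sum>i=0..n. \<Sum>p=0..n. B $ i * (A ^ i) $ p * H $ (n - p))"
    by (subst sum.swap) (simp add: sum_distrib_right)
  also have "\<dots> = (\<Sum>i=0..n. B $ i * (A ^ i * H) $ n)"
    by (simp add: fps_mult_nth sum_distrib_left mult.assoc)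
  finally show ?thesis .
qed

text \<open>Here \<open>i = j - k\<close> counts the block elements beyond the \<open>k\<close>
  prescribed ones. The cumulant depends on the block size alone and leaves the sum over
  sequences.\<close>

lemma partial_moment_eq_fps_nth:
  assumes "1 \<le> k"
  shows "partial_moment \<phi> \<psi> k X (k + m) = (\<Sum>i=0..m. R_cumulant \<phi> \<psi> (k + i) X *
    ((fps_X * M_series \<psi> X) ^ i * M_series \<phi> X) $ m)"
proof -
  have "partial_moment \<phi> \<psi> k X (k + m) = (\<Sum>i=0..m. \<Sum>s\<in>block_seqs k (k + i) (k + m).
        R_cumulant \<phi> \<psi> (k + i) X * \<phi> (X ^ (k + m - s (k + i))) *
        (\<Prod>r=k..<k + i. \<psi> (X ^ (s (r + 1) - 1 - s r))))"
    unfolding partial_moment_def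
    by (rule sum.reindex_bij_witness[where i = "\<lambda>i. k + i" and j = "\<lambda>j. j - k"]) auto
  also have "\<dots> = (\<Sum>i=0..m. R_cumulant \<phi> \<psi> (k + i) X *
      ((fps_X * M_series \<psi> X) ^ i * fps_X ^ k * M_series \<phi> X) $ (k + m))"
    using sum_block_seqs_eq_fps_nth[OF assms, where G = "M_series \<phi> X" and N = "M_series \<psi> X"]
    by (simp add: M_series_def sum_distrib_left[symmetric] mult.assoc)
  \<comment> \<open>The factor \<open>fps_X ^ k\<close> of the prescribed elements absorbs the shift
    from \<open>m\<close> to \<open>k + m\<close>.\<close>
  also have "\<dots> = (\<Sum>i=0..m. R_cumulant \<phi> \<psi> (k + i) X *
      ((fps_X * M_series \<psi> X) ^ i * M_series \<phi> X) $ m)"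
    by (simp add: mult.left_commute[of _ "fps_X ^ k"] mult.assoc fps_X_power_mult_nth)
  finally show ?thesis .
qed

theorem proposition4p1:
  fixes scaleC :: "complex \<Rightarrow> 'a::ring_1 \<Rightarrow> 'a"
    and star :: "'a \<Rightarrow> 'a"
    and \<phi> \<psi> :: "'a \<Rightarrow> complex"
    and X :: 'a
    and \<mu> \<nu> :: "real measure"
    and k :: nat
  assumes "two_state_algebra scaleC star \<phi> \<psi>"
    and "star X = X"
    and "law \<phi> X \<mu>"
    and "law \<psi> X \<nu>"
    and "k \<ge> 1"
  shows "C_series \<phi> \<psi> k X =
    fps_compose (R_series \<phi> \<psi> k X) (fps_X * M_series \<psi> X) * fps_X ^ k * M_series \<phi> X"
proof (rule fps_ext)
  fix n
  let ?A = "fps_X * M_series \<psi> X"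
  \<comment> \<open>With \<open>fps_X ^ k\<close> in front, the coefficients below \<open>k\<close>
    vanish, as those of \<open>C_series\<close> do by definition, and the one at
    \<open>k + m\<close> is that of the remaining product at \<open>m\<close>.\<close>
  have rhs: "fps_compose (R_series \<phi> \<psi> k X) ?A * fps_X ^ k * M_series \<phi> X =
      fps_X ^ k * (fps_compose (R_series \<phi> \<psi> k X) ?A * M_series \<phi> X)"
    by (simp only: mult_ac)
  show "C_series \<phi> \<psi> k X $ n =
      (fps_compose (R_series \<phi> \<psi> k X) ?A * fps_X ^ k * M_series \<phi> X) $ n"
  proof (cases "k \<le> n")
    case True
    then obtain m where "n = k + m" by (auto simp: le_iff_add)
    then show ?thesis
      unfolding rhs
      by (simp add: C_series_def R_series_def partial_moment_eq_fps_nth[OF \<open>k \<ge> 1\<close>]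
          fps_X_power_mult_nth fps_compose_mult_nth)
  next
    case False
    then show ?thesis
      unfolding rhs by (simp add: C_series_def fps_X_power_mult_nth)
  qed
qed

end
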